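(* Let $d\ge 1$, $h>0$, and let $\sigma_\alpha\colon\mathbb{Z}\to[0,\infty)$, $\alpha=1,\ldots,d$, be damping coefficients with $\sigma_\alpha(i)=0$ for all $i<0$. Let $U(t,\mathbf{i}) = e^{-\iota\omega t}e^{\iota\sum_{\alpha=1}^d k_\alpha h i_\alpha}$, with $k_\alpha\in\mathcal{K}$ for $\alpha=1,\ldots,d$, $\omega\in\mathbb{R}$, $\omega\neq 0$, be a discrete traveling wave that satisfies the discrete wave equation $$\frac{\partial^2 U}{\partial t^2} = \sum_{\alpha=1}^d\frac{1}{h^2}\left(-2U+\tau_\alpha^{-1}U+\tau_\alpha U\right)$$ in the physical domain $\bigcap_{\alpha=1}^d\{i_\alpha<0\}$. Then $U(t,\mathbf{i})$ can be uniquely extended to a solution of the discrete PML equations (with damping coefficients $\sigma_\alpha$) for all $\mathbf{i}\in\mathbb{Z}^d$: $$U(t,\mathbf{i}) = \left(\prod_{\alpha=1}^d r_\alpha(i_\alpha)\right)e^{-\iota\omega t}e^{\iota\sum_{\alpha=1}^d k_\alpha h i_\alpha},\qquad r_\alpha(i)=\begin{cases}1,& i\le 0,\\ \prod_{j=0}^{i-1}\rho(\sigma_\alpha(j),k_\alpha,\omega),& i>0,\end{cases}$$ where the geometric decay rate $$\rho(s,k_\alpha,\omega)=\frac{2+\iota\frac{s}{\omega}\left(1-e^{-\iota k_\alpha h}\right)}{2+\iota\frac{s}{\omega}\left(1-e^{\iota k_\alpha h}\right)}$$ satisfies, for $s>0$, $\omega\in\mathbb{R}$, $\omega\ne0$,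 $k_\alpha\in\mathcal{K}$, that $$|\rho(s,k_\alpha,\omega)|<1\qquad\text{and}\qquad \frac{|\rho(s,k_\alpha,\omega)|}{\left|\rho\left(s,-\overline{k_\alpha},\omega\right)\right|}<1$$ whenever $\operatorname{sgn}(\omega)\operatorname{Re}(k_\alpha)\in(0,\pi/h)$.
   Context: $\iota$ denotes the imaginary unit and $\overline{k}$ the complex conjugate of $k$. $h>0$ is the grid size. The set of admissible wave numbers is $$\mathcal{K}=\left\{k\in\mathbb{C}\ \middle|\ -\tfrac{\pi}{h}<\operatorname{Re}(k)\le\tfrac{\pi}{h},\ \operatorname{Im}(k)\le 0\right\}.$$ Multi-indices are $\mathbf{i}=(i_1,\ldots,i_d)\in\mathbb{Z}^d$. The shift operators act on functions of $(t,\mathbf{i})$ (or of $\mathbf{i}$) by $$(\tau_\alpha^{\pm1}U)(t,i_1,\ldots,i_\alpha,\ldots,i_d)=U(t,i_1,\ldots,i_\alpha\pm1,\ldots,i_d).$$ The damping coefficients are regarded as functions on $\mathbb{Z}^d$ by $\sigma_\alpha(\mathbf{i})=\sigma_\alpha(i_\alpha)$. The discrete PML equations are the following system for $U$ and auxiliary variables $\Phi_\alpha,\Psi_\alpha$ ($\alpha=1,\ldots,d$) on $\mathbb{R}\times\mathbb{Z}^d$: $$\frac{\partial^2 U}{\partial t^2} = \sum_{\alpha=1}^d \frac{1}{h^2}\left(-2U + \tau_\alpha^{-1}U + \tau_\alpha U\right) + \sum_{\alpha=1}^d\frac{1}{h}\left((\sigma_\alpha)(\tau_\alpha \Psi_\alpha)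 - (\tau_\alpha^{-1}\sigma_\alpha)(\tau_\alpha^{-1}\Phi_\alpha)\right),$$ $$\frac{\partial\Phi_\alpha}{\partial t} = -\frac{1}{2}\left((\tau_\alpha^{-1}\sigma_\alpha)(\tau_\alpha^{-1}\Phi_\alpha) + \sigma_\alpha\Phi_\alpha\right) - \frac{1}{2h}\left(\tau_\alpha U - \tau_\alpha^{-1}U\right),$$ $$\frac{\partial\Psi_\alpha}{\partial t} = -\frac{1}{2}\left((\tau_\alpha^{-1}\sigma_\alpha)(\Psi_\alpha) + (\sigma_\alpha)(\tau_\alpha\Psi_\alpha)\right) - \frac{1}{2h}\left(\tau_\alpha U - \tau_\alpha^{-1}U\right).$$ In the physical domain $\bigcap_\alpha\{i_\alpha<0\}$ the first equation reduces to the discrete wave equation. The variables $\Phi_\alpha$ (resp. $\Psi_\alpha$) and their evolution equations only need to be supported on $\{\mathbf{i}\in\mathbb{Z}^d : i_\alpha\ge 0\}$ (resp. $\{\mathbf{i}\in\mathbb{Z}^d : i_\alpha\ge 1\}$).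
   Formalization: Uniqueness is proved among fields of product form T(t)∏u_α(i_α), since it fails among arbitrary fields; the extension part assumes the denominators of ρ(σ_α(j),k_α,ω), j≥0, are nonzero, since otherwise the displayed formula is undefined. *)

theory Defs
  imports "HOL-Analysis.Analysis"
begin

text \<open>
  Multi-indices in \<open>\<int>\<^sup>d\<close> are functions \<open>'d \<Rightarrow> int\<close> on a finite index type \<open>'d\<close> with \<open>d = CARD('d) \<ge> 1\<close>.
  A field on \<open>\<real> \<times> \<int>\<^sup>d\<close> is a function \<open>U\<close> with \<open>U t i\<close> its value at time \<open>t\<close> and multi-index \<open>i\<close>.
\<close>

type_synonym 'd field = "real \<Rightarrow> ('d \<Rightarrow> int) \<Rightarrow> complex"

definition wave_numbers :: "real \<Rightarrow> complex set" where
  "wave_numbers h = {k. - pi / h < Re k \<and> Re k \<le> pi / h \<and> Im k \<le> 0}"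

definition physical_domain :: "('d \<Rightarrow> int) set" where
  "physical_domain = (\<Inter>\<alpha>. {i. i \<alpha> < 0})"

text \<open>\<open>shift \<alpha> 1\<close> and \<open>shift \<alpha> (-1)\<close> are the operators \<open>\<tau>\<^sub>\<alpha>\<close> and \<open>\<tau>\<^sub>\<alpha>\<close>-inverse.\<close>

definition shift :: "'d \<Rightarrow> int \<Rightarrow> (('d \<Rightarrow> int) \<Rightarrow> 'a) \<Rightarrow> ('d \<Rightarrow> int) \<Rightarrow> 'a" where
  "shift \<alpha> n f i = f (i(\<alpha> := i \<alpha> + n))"

definition damping :: "('d \<Rightarrow> int \<Rightarrow> real) \<Rightarrow> 'd \<Rightarrow> ('d \<Rightarrow> int) \<Rightarrow> complex" where
  "damping \<sigma> \<alpha> i = of_real (\<sigma> \<alpha> (i \<alpha>))"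

definition discrete_laplacian ::
    "real \<Rightarrow> (('d::finite \<Rightarrow> int) \<Rightarrow> complex) \<Rightarrow> ('d \<Rightarrow> int) \<Rightarrow> complex" where
  "discrete_laplacian h f i =
     (\<Sum>\<alpha>\<in>UNIV. 1 / (of_real h)\<^sup>2 * (- 2 * f i + shift \<alpha> (-1) f i + shift \<alpha> 1 f i))"

definition has_second_derivative :: "(real \<Rightarrow> complex) \<Rightarrow> (real \<Rightarrow> complex) \<Rightarrow> bool" where
  "has_second_derivative f f'' \<longleftrightarrow>
     (\<exists>f'. \<forall>t. (f has_vector_derivative f' t) (at t) \<and> (f' has_vector_derivative f'' t) (at t))"

definition discrete_wave_equation_on ::
    "real \<Rightarrow> ('d::finite \<Rightarrow> int) set \<Rightarrow> 'd field \<Rightarrow> bool" where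
  "discrete_wave_equation_on h S U \<longleftrightarrow>
     (\<forall>i\<in>S. has_second_derivative (\<lambda>t. U t i) (\<lambda>t. discrete_laplacian h (U t) i))"

definition discrete_PML ::
    "real \<Rightarrow> ('d::finite \<Rightarrow> int \<Rightarrow> real) \<Rightarrow>
      'd field \<Rightarrow> ('d \<Rightarrow> 'd field) \<Rightarrow> ('d \<Rightarrow> 'd field) \<Rightarrow> bool" where
  "discrete_PML h \<sigma> U \<Phi> \<Psi> \<longleftrightarrow>
     (\<forall>i. has_second_derivative (\<lambda>t. U t i)
        (\<lambda>t. discrete_laplacian h (U t) i
           + (\<Sum>\<alpha>\<in>UNIV. 1 / of_real h *
                (damping \<sigma> \<alpha> i * shift \<alpha> 1 (\<Psi> \<alpha> t) i
                 - shift \<alpha> (-1) (damping \<sigma> \<alpha>) i * shift \<alpha> (-1) (\<Phi> \<alpha> t) i)))) \<and>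
     (\<forall>\<alpha> i t. ((\<lambda>t. \<Phi> \<alpha> t i) has_vector_derivative
        (- 1 / 2 * (shift \<alpha> (-1) (damping \<sigma> \<alpha>) i * shift \<alpha> (-1) (\<Phi> \<alpha> t) i
                    + damping \<sigma> \<alpha> i * \<Phi> \<alpha> t i)
         - 1 / (2 * of_real h) * (shift \<alpha> 1 (U t) i - shift \<alpha> (-1) (U t) i))) (at t)) \<and>
     (\<forall>\<alpha> i t. ((\<lambda>t. \<Psi> \<alpha> t i) has_vector_derivative
        (- 1 / 2 * (shift \<alpha> (-1) (damping \<sigma> \<alpha>) i * \<Psi> \<alpha> t i
                    + damping \<sigma> \<alpha> i * shift \<alpha> 1 (\<Psi> \<alpha> t) i)
         - 1 / (2 * of_real h) * (shift \<alpha> 1 (U t) i - shift \<alpha> (-1) (U t) i))) (at t))"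

definition traveling_wave :: "real \<Rightarrow> ('d::finite \<Rightarrow> complex) \<Rightarrow> real \<Rightarrow> 'd field" where
  "traveling_wave h k \<omega> t i =
     exp (- \<i> * of_real \<omega> * of_real t) *
     exp (\<i> * (\<Sum>\<alpha>\<in>UNIV. k \<alpha> * of_real h * of_int (i \<alpha>)))"

text \<open>
  \<open>V\<close> extends \<open>U\<close> from the physical domain to a solution of the discrete PML equations. Only \<open>U\<close> is
  being extended; the auxiliary fields are existentially quantified and unrestricted in time and space.
\<close>

definition PML_extension ::
    "real \<Rightarrow> ('d::finite \<Rightarrow> int \<Rightarrow> real) \<Rightarrow> 'd field \<Rightarrow> 'd field \<Rightarrow> bool" where
  "PML_extension h \<sigma> U V \<longleftrightarrow>
     (\<forall>t. \<forall>i\<in>physical_domain. V t i = U t i) \<and> (\<exists>\<Phi> \<Psi>. discrete_PML h \<sigma> V \<Phi> \<Psi>)"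

text \<open>
  The class of fields, containing all traveling waves, within which the extension is unique.
  Among arbitrary fields it is not: for \<open>d = 1\<close> the layer supports nonzero modes \<open>exp (\<lambda> * t)\<close> with
  \<open>U = 0\<close> on all \<open>i \<le> 0\<close>, and for \<open>d \<ge> 2\<close> even the undamped time-harmonic equation has nonzero
  solutions vanishing on the physical domain, which is a single orthant.
\<close>

definition separated :: "'d::finite field \<Rightarrow> bool" where
  "separated V \<longleftrightarrow> (\<exists>T u. \<forall>t i. V t i = T t * (\<Prod>\<alpha>\<in>UNIV. u \<alpha> (i \<alpha>)))"

definition decay_num :: "real \<Rightarrow> real \<Rightarrow> complex \<Rightarrow> real \<Rightarrow> complex" where
  "decay_num h s k \<omega> = 2 + \<i> * of_real (s / \<omega>) * (1 - exp (- \<i> * k * of_real h))"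

definition decay_den :: "real \<Rightarrow> real \<Rightarrow> complex \<Rightarrow> real \<Rightarrow> complex" where
  "decay_den h s k \<omega> = 2 + \<i> * of_real (s / \<omega>) * (1 - exp (\<i> * k * of_real h))"

definition decay_rate :: "real \<Rightarrow> real \<Rightarrow> complex \<Rightarrow> real \<Rightarrow> complex" where
  "decay_rate h s k \<omega> = decay_num h s k \<omega> / decay_den h s k \<omega>"

definition attenuation :: "real \<Rightarrow> (int \<Rightarrow> real) \<Rightarrow> complex \<Rightarrow> real \<Rightarrow> int \<Rightarrow> complex" where
  "attenuation h s k \<omega> i = (if i \<le> 0 then 1 else \<Prod>j\<in>{0..i - 1}. decay_rate h (s j) k \<omega>)"

definition attenuated_wave ::
    "real \<Rightarrow> ('d::finite \<Rightarrow> int \<Rightarrow> real) \<Rightarrow> ('d \<Rightarrow> complex) \<Rightarrow> real \<Rightarrow> 'd field" where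
  "attenuated_wave h \<sigma> k \<omega> t i =
     (\<Prod>\<alpha>\<in>UNIV. attenuation h (\<sigma> \<alpha>) (k \<alpha>) \<omega> (i \<alpha>)) * traveling_wave h k \<omega> t i"

end

theory Submission
  imports Defs
begin

text \<open>
  Write \<open>z = exp (\<i> k h)\<close> and \<open>v (n + 1) = \<rho> (\<sigma> n) z v n\<close> for the attenuated mode in one direction. The auxiliary
  fields with profiles \<open>\<phi> n = \<i> (1 / z - z) v n / (\<omega> h den n)\<close> and \<open>\<psi> (n + 1) = z \<phi> n\<close> satisfy
  \<open>\<sigma> n \<phi> n = (v n - v (n + 1) / z) / h\<close>, so the damping terms turn the discrete Laplacian of \<open>v\<close> into
  \<open>(z + 1 / z - 2) v / h\<^sup>2\<close>, and existence reduces to the dispersion relation.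

  For uniqueness, restrict the difference of two separated solutions to a line on which all other
  coordinates lie in the physical domain, where it has the form \<open>exp (- \<i> \<omega> t) \<delta> n\<close>. The auxiliary fields
  need not be time-harmonic, but if \<open>\<delta>\<close> vanishes up to \<open>n\<close>, the wave equation at \<open>n\<close> and \<open>n + 1\<close> eliminates
  \<open>\<psi>\<close> and \<open>\<delta> (n + 2)\<close>, and differentiating once more in time leaves \<open>num \<cdot> den \<cdot> \<delta> (n + 1) = 0\<close>. The
  numerator never vanishes for \<open>Im k \<le> 0\<close>.
\<close>

section \<open>Time-harmonic factor and its derivatives\<close>

definition phase :: "real \<Rightarrow> real \<Rightarrow> complex" where
  "phase \<omega> t = exp (- \<i> * of_real \<omega> * of_real t)"

lemma phase_nonzero [simp]: "phase \<omega> t \<noteq> 0"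
  by (simp add: phase_def)

lemma phase_0 [simp]: "phase \<omega> 0 = 1"
  by (simp add: phase_def)

lemma has_vector_derivative_phase:
  "((\<lambda>t. phase \<omega> t * a) has_vector_derivative (- \<i> * of_real \<omega> * (phase \<omega> t * a))) (at t)"
proof -
  have "((\<lambda>z. exp (- \<i> * of_real \<omega> * z) * a) has_field_derivative
      exp (- \<i> * of_real \<omega> * of_real t) * (- \<i> * of_real \<omega>) * a) (at (of_real t))"
    by (auto intro!: derivative_eq_intros)
  from has_vector_derivative_real_field[OF this] show ?thesis
    by (simp add: phase_def algebra_simps)
qed

text \<open>Time derivatives are unique, so the second one is forced. One direction verifies the
  wave equation for an explicit wave, the other extracts from an assumed solution an algebraic
  identity at every time.\<close>

lemma has_second_derivative_phase_iff:
  "has_second_derivative (\<lambda>t. phase \<omega> t * a) f \<longleftrightarrow> (\<forall>t. f t = - (of_real \<omega>)\<^sup>2 * (phase \<omega> t * a))"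
proof -
  have D1: "((\<lambda>t. phase \<omega> t * b) has_vector_derivative - \<i> * of_real \<omega> * (phase \<omega> t * b)) (at t)" for t b
    by (rule has_vector_derivative_phase)
  have D2: "((\<lambda>t. - \<i> * of_real \<omega> * (phase \<omega> t * a)) has_vector_derivative
      - (of_real \<omega>)\<^sup>2 * (phase \<omega> t * a)) (at t)" for t
  proof -
    have "((\<lambda>t. - \<i> * of_real \<omega> * (phase \<omega> t * a)) has_vector_derivative
      - \<i> * of_real \<omega> * (- \<i> * of_real \<omega> * (phase \<omega> t * a))) (at t)"
      by (rule has_vector_derivative_mult_right[OF D1])
    also have "- \<i> * of_real \<omega> * (- \<i> * of_real \<omega> * (phase \<omega> t * a)) = - (of_real \<omega>)\<^sup>2 * (phase \<omega> t * a)"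
      by (simp add: power2_eq_square algebra_simps)
    finally show ?thesis .
  qed
  show ?thesis
  proof
    assume "has_second_derivative (\<lambda>t. phase \<omega> t * a) f"
    then obtain f' where f': "\<And>t. ((\<lambda>t. phase \<omega> t * a) has_vector_derivative f' t) (at t)"
      "\<And>t. (f' has_vector_derivative f t) (at t)"
      by (auto simp: has_second_derivative_def)
    have "f' = (\<lambda>t. - \<i> * of_real \<omega> * (phase \<omega> t * a))"
      using vector_derivative_unique_at[OF f'(1) D1] by auto
    with f'(2) D2 show "\<forall>t. f t = - (of_real \<omega>)\<^sup>2 * (phase \<omega> t * a)"
      using vector_derivative_unique_at by metis
  next
    assume "\<forall>t. f t = - (of_real \<omega>)\<^sup>2 * (phase \<omega> t * a)"
    then show "has_second_derivative (\<lambda>t. phase \<omega> t * a) f"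
      unfolding has_second_derivative_def
      by (intro exI[of _ "\<lambda>t. - \<i> * of_real \<omega> * (phase \<omega> t * a)"]) (use D1 D2 in auto)
  qed
qed

section \<open>Linearity of the discrete PML system\<close>

lemma has_second_derivative_diff:
  assumes "has_second_derivative f f''" "has_second_derivative g g''"
  shows "has_second_derivative (\<lambda>t. f t - g t) (\<lambda>t. f'' t - g'' t)"
proof -
  obtain f' g' where "\<And>t. (f has_vector_derivative f' t) (at t) \<and> (f' has_vector_derivative f'' t) (at t)"
    "\<And>t. (g has_vector_derivative g' t) (at t) \<and> (g' has_vector_derivative g'' t) (at t)"
    using assms by (auto simp: has_second_derivative_def)
  then show ?thesis
    unfolding has_second_derivative_def
    by (intro exI[of _ "\<lambda>t. f' t - g' t"]) (auto intro: has_vector_derivative_diff)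
qed

lemma discrete_laplacian_diff:
  "discrete_laplacian h (\<lambda>i. f i - g i) i = discrete_laplacian h f i - discrete_laplacian h g i"
  by (simp add: discrete_laplacian_def shift_def sum_subtractf[symmetric] algebra_simps)

text \<open>The damping does not depend on the fields, so the equations are linear in
  \<open>U\<close>, \<open>\<Phi>\<close> and \<open>\<Psi>\<close> jointly. Uniqueness thereby
  becomes a statement about a difference of solutions.\<close>

lemma discrete_PML_diff:
  fixes U V :: "'d::finite field"
  assumes U: "discrete_PML h \<sigma> U \<Phi> \<Psi>" and V: "discrete_PML h \<sigma> V \<Phi>' \<Psi>'"
  shows "discrete_PML h \<sigma> (\<lambda>t i. U t i - V t i) (\<lambda>\<alpha> t i. \<Phi> \<alpha> t i - \<Phi>' \<alpha> t i)
    (\<lambda>\<alpha> t i. \<Psi> \<alpha> t i - \<Psi>' \<alpha> t i)"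
  unfolding discrete_PML_def
proof (intro conjI allI, goal_cases)
  case (1 i)
  define F where "F \<Phi> \<Psi> t \<alpha> = 1 / of_real h * (damping \<sigma> \<alpha> i * shift \<alpha> 1 (\<Psi> \<alpha> t) i
    - shift \<alpha> (-1) (damping \<sigma> \<alpha>) i * shift \<alpha> (-1) (\<Phi> \<alpha> t) i)" for \<Phi> \<Psi> :: "'d \<Rightarrow> 'd field" and t \<alpha>
  have F: "1 / of_real h * (damping \<sigma> \<alpha> i * shift \<alpha> 1 (\<lambda>i. \<Psi> \<alpha> t i - \<Psi>' \<alpha> t i) i
    - shift \<alpha> (-1) (damping \<sigma> \<alpha>) i * shift \<alpha> (-1) (\<lambda>i. \<Phi> \<alpha> t i - \<Phi>' \<alpha> t i) i) = F \<Phi> \<Psi> t \<alpha> - F \<Phi>' \<Psi>' t \<alpha>" for t \<alpha>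
    by (simp add: F_def shift_def algebra_simps diff_divide_distrib add_divide_distrib)
  have "has_second_derivative (\<lambda>t. U t i - V t i) (\<lambda>t. (discrete_laplacian h (U t) i + sum (F \<Phi> \<Psi> t) UNIV)
      - (discrete_laplacian h (V t) i + sum (F \<Phi>' \<Psi>' t) UNIV))"
    using U V unfolding discrete_PML_def F_def by (intro has_second_derivative_diff) auto
  then show ?case
    by (simp only: F discrete_laplacian_diff sum_subtractf add_diff_add)
next
  case (2 \<alpha> i t)
  from has_vector_derivative_diff[OF U[unfolded discrete_PML_def, THEN conjunct2, THEN conjunct1, rule_format]
      V[unfolded discrete_PML_def, THEN conjunct2, THEN conjunct1, rule_format], of \<alpha> i \<alpha> i t]
  show ?case
    by (simp add: shift_def algebra_simps diff_divide_distrib add_divide_distrib)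
next
  case (3 \<alpha> i t)
  from has_vector_derivative_diff[OF U[unfolded discrete_PML_def, THEN conjunct2, THEN conjunct2, rule_format]
      V[unfolded discrete_PML_def, THEN conjunct2, THEN conjunct2, rule_format], of \<alpha> i \<alpha> i t]
  show ?case
    by (simp add: shift_def algebra_simps diff_divide_distrib add_divide_distrib)
qed

section \<open>One-dimensional modes and the product form of the waves\<close>

definition layer_mode :: "real \<Rightarrow> (int \<Rightarrow> real) \<Rightarrow> complex \<Rightarrow> real \<Rightarrow> int \<Rightarrow> complex" where
  "layer_mode h s k \<omega> n = attenuation h s k \<omega> n * exp (\<i> * k * of_real h * of_int n)"

lemma layer_mode_nonpos: "n \<le> 0 \<Longrightarrow> layer_mode h s k \<omega> n = exp (\<i> * k * of_real h * of_int n)"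
  by (simp add: layer_mode_def attenuation_def)

lemma traveling_wave_eq_prod:
  "traveling_wave h k \<omega> t i = phase \<omega> t * (\<Prod>\<alpha>\<in>UNIV. exp (\<i> * k \<alpha> * of_real h * of_int (i \<alpha>)))"
  by (simp add: traveling_wave_def phase_def sum_distrib_left exp_sum mult.assoc)

lemma attenuated_wave_eq_prod:
  "attenuated_wave h \<sigma> k \<omega> t i = phase \<omega> t * (\<Prod>\<alpha>\<in>UNIV. layer_mode h (\<sigma> \<alpha>) (k \<alpha>) \<omega> (i \<alpha>))"
  by (simp add: attenuated_wave_def traveling_wave_eq_prod layer_mode_def prod.distrib)

text \<open>Where \<open>s n = 0\<close>, numerator and denominator both equal \<open>2\<close> and
  the rate is \<open>1\<close>. The constant branch of \<open>attenuation\<close> thus obeys the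
  same recursion, and later identities need no case split at the interface.\<close>

lemma layer_mode_step:
  assumes "\<And>n. n < 0 \<Longrightarrow> s n = 0"
  shows "layer_mode h s k \<omega> (n + 1) = decay_rate h (s n) k \<omega> * exp (\<i> * k * of_real h) * layer_mode h s k \<omega> n"
proof -
  have "attenuation h s k \<omega> (n + 1) = decay_rate h (s n) k \<omega> * attenuation h s k \<omega> n"
  proof (cases "n < 0")
    case True
    then show ?thesis
      using assms[of n] by (simp add: attenuation_def decay_rate_def decay_num_def decay_den_def)
  next
    case False
    then have "{0..n} = insert n {0..n - 1}" by auto
    then show ?thesis using False by (auto simp: attenuation_def)
  qed
  then show ?thesis
    by (simp add: layer_mode_def exp_add ring_distribs mult_ac)
qed

lemma UNIV_prod_fun_upd:
  "(\<Prod>\<beta>\<in>UNIV. u \<beta> ((i(\<alpha> := n)) \<beta>)) = u \<alpha> n * (\<Prod>\<beta>\<in>UNIV - {\<alpha>}. u \<beta> (i \<beta>))"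
  for u :: "'d::finite \<Rightarrow> 'a \<Rightarrow> 'b::comm_monoid_mult"
proof -
  have "(\<Prod>\<beta>\<in>UNIV - {\<alpha>}. u \<beta> ((i(\<alpha> := n)) \<beta>)) = (\<Prod>\<beta>\<in>UNIV - {\<alpha>}. u \<beta> (i \<beta>))"
    by (rule prod.cong) auto
  then show ?thesis by (simp add: prod.remove[of UNIV \<alpha>])
qed

section \<open>Dispersion relation\<close>

text \<open>The traveling wave is an eigenfunction of every shift and never zero, so the wave
  equation at one point and time \<open>0\<close> suffices.\<close>

lemma dispersion_relation:
  fixes k :: "'d::finite \<Rightarrow> complex"
  assumes "discrete_wave_equation_on h physical_domain (traveling_wave h k \<omega>)"
  shows "- (of_real \<omega>)\<^sup>2 =
    (\<Sum>\<alpha>\<in>UNIV. 1 / (of_real h)\<^sup>2 * (exp (\<i> * k \<alpha> * of_real h) + exp (- \<i> * k \<alpha> * of_real h) - 2))"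
proof -
  \<comment> \<open>Neighbours with a coordinate \<open>0\<close> leave the physical domain. This is
    harmless, since the traveling wave is given by its formula everywhere.\<close>
  define i :: "'d \<Rightarrow> int" where "i = (\<lambda>_. - 1)"
  define a where "a = (\<Prod>\<alpha>\<in>UNIV. exp (\<i> * k \<alpha> * of_real h * of_int (i \<alpha>)))"
  have "i \<in> physical_domain" by (simp add: physical_domain_def i_def)
  with assms have "has_second_derivative (\<lambda>t. phase \<omega> t * a)
      (\<lambda>t. discrete_laplacian h (traveling_wave h k \<omega> t) i)"
    unfolding discrete_wave_equation_on_def traveling_wave_eq_prod a_def by blast
  then have L: "discrete_laplacian h (traveling_wave h k \<omega> 0) i = - (of_real \<omega>)\<^sup>2 * a"
    by (simp add: has_second_derivative_phase_iff)
  have up: "traveling_wave h k \<omega> 0 (i(\<alpha> := i \<alpha> + n)) = exp (\<i> * k \<alpha> * of_real h * of_int n) * a" for \<alpha> n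
    unfolding traveling_wave_eq_prod
    by (subst UNIV_prod_fun_upd[of "\<lambda>\<alpha> n. exp (\<i> * k \<alpha> * of_real h * of_int n)"])
      (simp add: a_def prod.remove[of UNIV \<alpha>] ring_distribs exp_add)
  have base: "traveling_wave h k \<omega> 0 i = a"
    by (simp add: traveling_wave_eq_prod a_def)
  have "(\<Sum>\<alpha>\<in>UNIV. 1 / (of_real h)\<^sup>2 * (exp (\<i> * k \<alpha> * of_real h) + exp (- \<i> * k \<alpha> * of_real h) - 2)) * a
     = discrete_laplacian h (traveling_wave h k \<omega> 0) i"
    unfolding discrete_laplacian_def shift_def up base sum_distrib_right
    by (rule sum.cong) (simp_all add: algebra_simps diff_divide_distrib add_divide_distrib)
  moreover have "a \<noteq> 0" by (simp add: a_def)
  ultimately show ?thesis using mult_right_cancel[OF \<open>a \<noteq> 0\<close>, THEN iffD1] by (simp only: L)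
qed

section \<open>Auxiliary profiles in one direction\<close>

text \<open>Solving \<open>s n * f n = (v n - v (n + 1) / z) / h\<close> for \<open>f n\<close> and
  cancelling the factor \<open>s n\<close> gives this formula, which still makes sense where
  \<open>s n = 0\<close>.\<close>

definition layer_flux :: "real \<Rightarrow> (int \<Rightarrow> real) \<Rightarrow> complex \<Rightarrow> real \<Rightarrow> int \<Rightarrow> complex" where
  "layer_flux h s k \<omega> n = \<i> * (exp (- \<i> * k * of_real h) - exp (\<i> * k * of_real h))
     / (of_real \<omega> * of_real h * decay_den h (s n) k \<omega>) * layer_mode h s k \<omega> n"

context
  fixes h \<omega> :: real and s :: "int \<Rightarrow> real" and k :: complex and z :: complex and v f :: "int \<Rightarrow> complex"
  assumes h: "h > 0" and \<omega>: "\<omega> \<noteq> 0" and s: "\<And>n. n < 0 \<Longrightarrow> s n = 0"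
    and den: "\<And>n. decay_den h (s n) k \<omega> \<noteq> 0"
  defines "z \<equiv> exp (\<i> * k * of_real h)"
    and "v \<equiv> layer_mode h s k \<omega>" and "f \<equiv> layer_flux h s k \<omega>"
begin

lemma exp_wave_number_nonzero: "z \<noteq> 0" by (simp add: z_def)

lemma exp_minus_wave_number: "exp (- (\<i> * k * of_real h)) = 1 / z"
  by (simp add: z_def exp_minus field_simps)

lemma decay_den_eq: "decay_den h x k \<omega> = 2 + \<i> * of_real x / of_real \<omega> * (1 - z)"
  by (simp add: decay_den_def z_def)

lemma decay_den_mult_layer_mode: "decay_den h (s n) k \<omega> * v (n + 1) = (2 + \<i> * of_real (s n) / of_real \<omega> * (1 - 1 / z)) * z * v n"
proof -
  have "v (n + 1) = decay_rate h (s n) k \<omega> * z * v n"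
    unfolding v_def z_def by (rule layer_mode_step) (rule s)
  then show ?thesis
    using den[of n] exp_minus_wave_number by (simp add: decay_rate_def decay_num_def)
qed

lemma decay_den_mult_layer_flux: "of_real \<omega> * of_real h * decay_den h (s n) k \<omega> * f n = \<i> * (1 / z - z) * v n"
  using den[of n] h \<omega> exp_minus_wave_number by (simp add: f_def layer_flux_def v_def z_def)

text \<open>The difference of denominator and numerator is
  \<open>\<i> * s n / \<omega> * (1 / z - z)\<close>, which is the factor in
  \<open>layer_flux\<close> up to \<open>s n\<close>.\<close>

lemma damped_layer_flux: "of_real (s n) * f n = (z * v n - v (n + 1)) / (of_real h * z)"
proof -
  have "(decay_den h (s n) k \<omega> * of_real \<omega>) * (of_real h * z * (of_real (s n) * f n))
     = of_real (s n) * z * (\<i> * (1 / z - z) * v n)"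
    by (simp flip: decay_den_mult_layer_flux)
  also have "\<dots> = of_real \<omega> * (decay_den h (s n) k \<omega> * z * v n - (2 + \<i> * of_real (s n) / of_real \<omega> * (1 - 1 / z)) * z * v n)"
    unfolding decay_den_eq using exp_wave_number_nonzero \<omega> by (simp add: field_simps)
  also have "\<dots> = (decay_den h (s n) k \<omega> * of_real \<omega>) * (z * v n - v (n + 1))"
    unfolding decay_den_mult_layer_mode[symmetric] by (simp add: algebra_simps)
  finally have "of_real h * z * (of_real (s n) * f n) = z * v n - v (n + 1)"
    using den[of n] \<omega> by simp
  then show ?thesis using h exp_wave_number_nonzero by (simp add: field_simps)
qed

text \<open>In denominator plus \<open>z\<close> times numerator the terms with \<open>s n\<close>
  cancel and \<open>2 * (1 + z)\<close> remains.\<close>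

lemma layer_flux_eq_average: "- \<i> * of_real \<omega> * f n = (1 - z) * (v n + v (n + 1)) / (2 * of_real h * z)"
proof -
  have "decay_den h (s n) k \<omega> * (2 * of_real h * z * (- \<i> * of_real \<omega> * f n))
     = - \<i> * 2 * z * (\<i> * (1 / z - z) * v n)"
    by (simp flip: decay_den_mult_layer_flux)
  also have "\<dots> = (1 - z) * (decay_den h (s n) k \<omega> * v n + (2 + \<i> * of_real (s n) / of_real \<omega> * (1 - 1 / z)) * z * v n)"
    unfolding decay_den_eq using exp_wave_number_nonzero \<omega> by (simp add: field_simps)
  also have "\<dots> = decay_den h (s n) k \<omega> * ((1 - z) * (v n + v (n + 1)))"
    unfolding decay_den_mult_layer_mode[symmetric] by (simp add: algebra_simps)
  finally have "2 * of_real h * z * (- \<i> * of_real \<omega> * f n) = (1 - z) * (v n + v (n + 1))"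
    using den[of n] by (metis mult_left_cancel)
  then show ?thesis using h exp_wave_number_nonzero by (simp add: field_simps)
qed

text \<open>The damping terms cancel both neighbour values \<open>v (n - 1)\<close> and
  \<open>v (n + 1)\<close>, leaving the symbol of the undamped Laplacian.\<close>

lemma layer_laplacian:
  "1 / (of_real h)\<^sup>2 * (- 2 * v n + v (n - 1) + v (n + 1))
     + 1 / of_real h * (of_real (s n) * (z * f n) - of_real (s (n - 1)) * f (n - 1))
   = 1 / (of_real h)\<^sup>2 * (z + 1 / z - 2) * v n"
proof -
  have D: "of_real (s n) * (z * f n) = (z * v n - v (n + 1)) / of_real h"
    using damped_layer_flux[of n] exp_wave_number_nonzero h by (simp add: field_simps)
  have D': "of_real (s (n - 1)) * f (n - 1) = (z * v (n - 1) - v n) / (of_real h * z)"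
    using damped_layer_flux[of "n - 1"] by simp
  show ?thesis unfolding D D' using h exp_wave_number_nonzero
    by (simp add: field_simps power2_eq_square)
qed

text \<open>This and \<open>layer_flux_backward\<close> are the evolution equations of
  \<open>\<Phi>\<close> and \<open>\<Psi>\<close> for time-harmonic fields. Damping terms and
  centred difference combine to the average in \<open>layer_flux_eq_average\<close>.\<close>

lemma layer_flux_forward:
  "- \<i> * of_real \<omega> * f n = - 1 / 2 * (of_real (s (n - 1)) * f (n - 1) + of_real (s n) * f n)
     - 1 / (2 * of_real h) * (v (n + 1) - v (n - 1))"
  unfolding layer_flux_eq_average damped_layer_flux using h exp_wave_number_nonzero by (simp add: field_simps)

lemma layer_flux_backward:
  "- \<i> * of_real \<omega> * (z * f (n - 1)) =
     - 1 / 2 * (of_real (s (n - 1)) * (z * f (n - 1)) + of_real (s n) * (z * f n))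
     - 1 / (2 * of_real h) * (v (n + 1) - v (n - 1))"
proof -
  have D: "of_real (s m) * (z * f m) = (z * v m - v (m + 1)) / of_real h"
    "- \<i> * of_real \<omega> * (z * f m) = (1 - z) * (v m + v (m + 1)) / (2 * of_real h)" for m
    using damped_layer_flux[of m] layer_flux_eq_average[of m] exp_wave_number_nonzero h by (simp_all add: field_simps)
  show ?thesis unfolding D using h by (simp add: field_simps)
qed

end

section \<open>Existence of the extension\<close>

lemma attenuated_wave_PML:
  fixes k :: "'d::finite \<Rightarrow> complex"
  assumes h: "h > 0" and \<omega>: "\<omega> \<noteq> 0" and \<sigma>: "\<And>\<alpha> n. n < 0 \<Longrightarrow> \<sigma> \<alpha> n = 0"
    and den: "\<And>\<alpha> n. decay_den h (\<sigma> \<alpha> n) (k \<alpha>) \<omega> \<noteq> 0"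
    and wave: "discrete_wave_equation_on h physical_domain (traveling_wave h k \<omega>)"
  shows "\<exists>\<Phi> \<Psi>. discrete_PML h \<sigma> (attenuated_wave h \<sigma> k \<omega>) \<Phi> \<Psi>"
proof -
  define z where "z \<alpha> = exp (\<i> * k \<alpha> * of_real h)" for \<alpha>
  define v where "v \<alpha> = layer_mode h (\<sigma> \<alpha>) (k \<alpha>) \<omega>" for \<alpha>
  define f where "f \<alpha> = layer_flux h (\<sigma> \<alpha>) (k \<alpha>) \<omega>" for \<alpha>
  \<comment> \<open>\<open>C \<alpha>\<close> does not change under shifts in direction
    \<open>\<alpha>\<close>, so each equation is a multiple of a one-dimensional identity.\<close>
  define C where "C \<alpha> i = (\<Prod>\<beta>\<in>UNIV - {\<alpha>}. v \<beta> (i \<beta>))" for \<alpha> and i :: "'d \<Rightarrow> int"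
  define \<Phi> where "\<Phi> \<alpha> t i = phase \<omega> t * (f \<alpha> (i \<alpha>) * C \<alpha> i)" for \<alpha> t i
  \<comment> \<open>The offset \<open>- 1\<close> makes the forward shift of \<open>\<Psi>\<close>
    equal to \<open>z \<alpha>\<close> times \<open>\<Phi>\<close> at the unshifted point.\<close>
  define \<Psi> where "\<Psi> \<alpha> t i = phase \<omega> t * (z \<alpha> * f \<alpha> (i \<alpha> - 1) * C \<alpha> i)" for \<alpha> t i
  have C_upd [simp]: "C \<alpha> (i(\<alpha> := n)) = C \<alpha> i" for \<alpha> i n
    unfolding C_def by (rule prod.cong) auto
  have U: "attenuated_wave h \<sigma> k \<omega> t i = phase \<omega> t * (v \<alpha> (i \<alpha>) * C \<alpha> i)" for t i \<alpha>
    by (simp add: attenuated_wave_eq_prod v_def C_def prod.remove[of UNIV \<alpha>])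
  have U_upd: "attenuated_wave h \<sigma> k \<omega> t (i(\<alpha> := n)) = phase \<omega> t * (v \<alpha> n * C \<alpha> i)" for t i \<alpha> n
    by (simp add: U[of _ _ \<alpha>])
  note layer = layer_laplacian[where s = "\<sigma> \<alpha>" and k = "k \<alpha>" for \<alpha>, OF h \<omega> \<sigma> den, folded z_def v_def f_def]
    layer_flux_forward[where s = "\<sigma> \<alpha>" and k = "k \<alpha>" for \<alpha>, OF h \<omega> \<sigma> den, folded z_def v_def f_def]
    layer_flux_backward[where s = "\<sigma> \<alpha>" and k = "k \<alpha>" for \<alpha>, OF h \<omega> \<sigma> den, folded z_def v_def f_def]
  have "discrete_PML h \<sigma> (attenuated_wave h \<sigma> k \<omega>) \<Phi> \<Psi>"
    unfolding discrete_PML_def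
  proof (intro conjI allI, goal_cases)
    case (1 i)
    define P where "P = (\<Prod>\<beta>\<in>UNIV. v \<beta> (i \<beta>))"
    have P: "P = v \<alpha> (i \<alpha>) * C \<alpha> i" for \<alpha>
      by (simp add: P_def C_def prod.remove[of UNIV \<alpha>])
    have "discrete_laplacian h (attenuated_wave h \<sigma> k \<omega> t) i
         + (\<Sum>\<alpha>\<in>UNIV. 1 / of_real h * (damping \<sigma> \<alpha> i * shift \<alpha> 1 (\<Psi> \<alpha> t) i
           - shift \<alpha> (-1) (damping \<sigma> \<alpha>) i * shift \<alpha> (-1) (\<Phi> \<alpha> t) i))
       = - (of_real \<omega>)\<^sup>2 * (phase \<omega> t * P)" for t
    proof -
      have "1 / (of_real h)\<^sup>2 * (- 2 * attenuated_wave h \<sigma> k \<omega> t i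
           + shift \<alpha> (-1) (attenuated_wave h \<sigma> k \<omega> t) i + shift \<alpha> 1 (attenuated_wave h \<sigma> k \<omega> t) i)
         + 1 / of_real h * (damping \<sigma> \<alpha> i * shift \<alpha> 1 (\<Psi> \<alpha> t) i
           - shift \<alpha> (-1) (damping \<sigma> \<alpha>) i * shift \<alpha> (-1) (\<Phi> \<alpha> t) i)
         = 1 / (of_real h)\<^sup>2 * (z \<alpha> + exp (- \<i> * k \<alpha> * of_real h) - 2) * (phase \<omega> t * P)" for \<alpha>
      proof -
        have "(1 / (of_real h)\<^sup>2 * (- 2 * attenuated_wave h \<sigma> k \<omega> t i
             + shift \<alpha> (-1) (attenuated_wave h \<sigma> k \<omega> t) i + shift \<alpha> 1 (attenuated_wave h \<sigma> k \<omega> t) i)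
           + 1 / of_real h * (damping \<sigma> \<alpha> i * shift \<alpha> 1 (\<Psi> \<alpha> t) i
             - shift \<alpha> (-1) (damping \<sigma> \<alpha>) i * shift \<alpha> (-1) (\<Phi> \<alpha> t) i))
          = (1 / (of_real h)\<^sup>2 * (- 2 * v \<alpha> (i \<alpha>) + v \<alpha> (i \<alpha> - 1) + v \<alpha> (i \<alpha> + 1))
             + 1 / of_real h * (of_real (\<sigma> \<alpha> (i \<alpha>)) * (z \<alpha> * f \<alpha> (i \<alpha>))
             - of_real (\<sigma> \<alpha> (i \<alpha> - 1)) * f \<alpha> (i \<alpha> - 1))) * (phase \<omega> t * C \<alpha> i)"
          unfolding shift_def U_upd U[of _ _ \<alpha>] \<Phi>_def \<Psi>_def damping_def
          by (simp add: algebra_simps diff_divide_distrib add_divide_distrib)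
        also have "\<dots> = 1 / (of_real h)\<^sup>2 * (z \<alpha> + 1 / z \<alpha> - 2) * v \<alpha> (i \<alpha>) * (phase \<omega> t * C \<alpha> i)"
          by (simp only: layer(1))
        also have "1 / z \<alpha> = exp (- \<i> * k \<alpha> * of_real h)"
          by (simp add: z_def exp_minus field_simps)
        finally show ?thesis by (simp add: P[of \<alpha>])
      qed
      \<comment> \<open>Each direction now contributes its undamped symbol times the same value, and
        the dispersion relation sums the symbols.\<close>
      then show ?thesis
        unfolding discrete_laplacian_def sum.distrib[symmetric] dispersion_relation[OF wave] sum_distrib_right z_def
        by simp
    qed
    then show ?case
      by (simp add: attenuated_wave_eq_prod has_second_derivative_phase_iff P_def v_def)
  next
    case (2 \<alpha> i t)
    have "- \<i> * of_real \<omega> * (phase \<omega> t * (f \<alpha> (i \<alpha>) * C \<alpha> i)) =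
        (- \<i> * of_real \<omega> * f \<alpha> (i \<alpha>)) * (phase \<omega> t * C \<alpha> i)"
      by simp
    also have "\<dots> = - 1 / 2 * (shift \<alpha> (-1) (damping \<sigma> \<alpha>) i * shift \<alpha> (-1) (\<Phi> \<alpha> t) i
        + damping \<sigma> \<alpha> i * \<Phi> \<alpha> t i) - 1 / (2 * of_real h) *
        (shift \<alpha> 1 (attenuated_wave h \<sigma> k \<omega> t) i - shift \<alpha> (-1) (attenuated_wave h \<sigma> k \<omega> t) i)"
      by (simp only: layer(2) shift_def U_upd \<Phi>_def damping_def) (simp add: algebra_simps diff_divide_distrib add_divide_distrib)
    finally show ?case
      using has_vector_derivative_phase[of \<omega> "f \<alpha> (i \<alpha>) * C \<alpha> i" t] by (simp only: \<Phi>_def)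
  next
    case (3 \<alpha> i t)
    have "- \<i> * of_real \<omega> * (phase \<omega> t * (z \<alpha> * f \<alpha> (i \<alpha> - 1) * C \<alpha> i)) =
        (- \<i> * of_real \<omega> * (z \<alpha> * f \<alpha> (i \<alpha> - 1))) * (phase \<omega> t * C \<alpha> i)"
      by simp
    also have "\<dots> = - 1 / 2 * (shift \<alpha> (-1) (damping \<sigma> \<alpha>) i * \<Psi> \<alpha> t i
        + damping \<sigma> \<alpha> i * shift \<alpha> 1 (\<Psi> \<alpha> t) i) - 1 / (2 * of_real h) *
        (shift \<alpha> 1 (attenuated_wave h \<sigma> k \<omega> t) i - shift \<alpha> (-1) (attenuated_wave h \<sigma> k \<omega> t) i)"
      by (simp only: layer(3) shift_def U_upd \<Psi>_def damping_def) (simp add: algebra_simps diff_divide_distrib add_divide_distrib)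
    finally show ?case
      using has_vector_derivative_phase[of \<omega> "z \<alpha> * f \<alpha> (i \<alpha> - 1) * C \<alpha> i" t] by (simp only: \<Psi>_def)
  qed
  then show ?thesis by blast
qed

section \<open>Uniqueness along a grid line\<close>

text \<open>Identifies the quadratic in \<open>s\<close> at which the elimination in
  \<open>line_solution_unique\<close> ends.\<close>

lemma decay_num_mult_den:
  assumes "\<omega> \<noteq> 0" and "z = exp (\<i> * k * of_real h)"
  shows "(of_real \<omega>)\<^sup>2 * (decay_num h s k \<omega> * decay_den h s k \<omega>) =
    4 * (of_real \<omega>)\<^sup>2 + (z + 1 / z - 2) * ((of_real s)\<^sup>2 - 2 * \<i> * of_real \<omega> * of_real s)"
proof -
  have z: "exp (- (\<i> * k * of_real h)) = 1 / z" "z \<noteq> 0"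
    using assms(2) by (simp_all add: exp_minus field_simps)
  have "of_real \<omega> * decay_num h s k \<omega> = 2 * of_real \<omega> + \<i> * of_real s * (1 - 1 / z)"
    "of_real \<omega> * decay_den h s k \<omega> = 2 * of_real \<omega> + \<i> * of_real s * (1 - z)"
    using assms z by (simp_all add: decay_num_def decay_den_def field_simps)
  moreover have "(of_real \<omega>)\<^sup>2 * (decay_num h s k \<omega> * decay_den h s k \<omega>) =
    (of_real \<omega> * decay_num h s k \<omega>) * (of_real \<omega> * decay_den h s k \<omega>)"
    by (simp add: power2_eq_square)
  ultimately have "(of_real \<omega>)\<^sup>2 * (decay_num h s k \<omega> * decay_den h s k \<omega>) =
    (2 * of_real \<omega> + \<i> * of_real s * (1 - 1 / z)) * (2 * of_real \<omega> + \<i> * of_real s * (1 - z))"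
    by simp
  then show ?thesis using z(2) by (simp add: field_simps power2_eq_square)
qed

text \<open>\<open>lap\<close> is the wave equation on the line after the dispersion relation has
  removed the other directions. The induction carries constancy in time of \<open>p (n - 1)\<close>
  along with \<open>\<delta> = 0\<close> up to \<open>n\<close>.\<close>

lemma line_solution_unique:
  fixes s :: "int \<Rightarrow> real" and \<delta> :: "int \<Rightarrow> complex" and \<phi> \<psi> :: "int \<Rightarrow> real \<Rightarrow> complex"
  assumes h: "h > 0" and \<omega>: "\<omega> \<noteq> 0" and s: "\<And>n. n < 0 \<Longrightarrow> s n = 0"
    and num: "\<And>n. decay_num h (s n) k \<omega> \<noteq> 0" and den: "\<And>n. decay_den h (s n) k \<omega> \<noteq> 0"
    and z: "z = exp (\<i> * k * of_real h)"
    and \<delta>: "\<And>n. n < 0 \<Longrightarrow> \<delta> n = 0"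
    and \<phi>: "\<And>n t. (\<phi> n has_vector_derivative
      (- 1 / 2 * (of_real (s (n - 1)) * \<phi> (n - 1) t + of_real (s n) * \<phi> n t)
       - 1 / (2 * of_real h) * (phase \<omega> t * \<delta> (n + 1) - phase \<omega> t * \<delta> (n - 1)))) (at t)"
    and \<psi>: "\<And>n t. (\<psi> n has_vector_derivative
      (- 1 / 2 * (of_real (s (n - 1)) * \<psi> n t + of_real (s n) * \<psi> (n + 1) t)
       - 1 / (2 * of_real h) * (phase \<omega> t * \<delta> (n + 1) - phase \<omega> t * \<delta> (n - 1)))) (at t)"
    and lap: "\<And>n t. of_real (s n) * \<psi> (n + 1) t - of_real (s (n - 1)) * \<phi> (n - 1) t
       = phase \<omega> t * (((z + 1 / z) * \<delta> n - \<delta> (n + 1) - \<delta> (n - 1)) / of_real h)"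
  shows "\<delta> n = 0"
proof -
  define p where "p m t = of_real (s m) * \<phi> m t" for m t
  \<comment> \<open>Only the derivative of the damped field \<open>p\<close> can be controlled: constants in time are not yet excluded.\<close>
  have "(\<forall>j\<le>n. \<delta> j = 0) \<and> (\<forall>t. (p (n - 1) has_vector_derivative 0) (at t))" if "n \<ge> - 1" for n
    using that
  proof (induction n rule: int_ge_induct)
    case base
    \<comment> \<open>Starting at \<open>- 1\<close> keeps the first damped field at index
      \<open>- 2\<close>, where the damping vanishes.\<close>
    have "p (- 1 - 1) = (\<lambda>_. 0)" by (simp add: p_def s fun_eq_iff)
    with \<delta> show ?case by auto
  next
    case (step n)
    define d where "d = \<delta> (n + 1) / of_real h"
    define d' where "d' = \<delta> (n + 2) / of_real h"
    define Z where "Z = z + 1 / z"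
    define S :: complex where "S = of_real (s n)"
    have d0: "\<delta> n = 0" "\<delta> (n - 1) = 0" and p': "\<And>t. (p (n - 1) has_vector_derivative 0) (at t)"
      using step.IH by auto
    \<comment> \<open>\<open>lap\<close> at \<open>n\<close> and at \<open>n + 1\<close> expresses
      the damped values of \<open>\<psi>\<close> through those of \<open>\<phi>\<close>.\<close>
    have q: "S * \<psi> (n + 1) t = p (n - 1) t - phase \<omega> t * d" for t
      using lap[of n t] d0 by (simp add: S_def p_def d_def diff_divide_distrib algebra_simps)
    have q': "of_real (s (n + 1)) * \<psi> (n + 2) t = p n t + phase \<omega> t * (Z * d - d')" for t
      using lap[of "n + 1" t] d0 by (simp add: p_def d_def d'_def Z_def diff_divide_distrib algebra_simps)
    \<comment> \<open>The unknown \<open>\<delta> (n + 2)\<close> enters once through \<open>q'\<close> and once through the centred difference, and cancels.\<close>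
    have avg: "2 * (- \<i> * of_real \<omega> * (phase \<omega> t * d)) =
        S * (p (n - 1) t + p n t + phase \<omega> t * ((Z - 1) * d))" for t
    proof -
      \<comment> \<open>The derivative of \<open>S * \<psi> (n + 1)\<close> is computed twice, from
        \<open>q\<close> and from the evolution equation.\<close>
      have A: "((\<lambda>t. S * \<psi> (n + 1) t) has_vector_derivative
          0 - (- \<i> * of_real \<omega> * (phase \<omega> t * d))) (at t)"
        unfolding q by (intro has_vector_derivative_diff p' has_vector_derivative_phase)
      have "((\<lambda>t. S * \<psi> (n + 1) t) has_vector_derivative
          S * (- 1 / 2 * (S * \<psi> (n + 1) t + of_real (s (n + 1)) * \<psi> (n + 2) t)
            - 1 / 2 * (phase \<omega> t * d'))) (at t)"
        using has_vector_derivative_mult_right[OF \<psi>[of "n + 1" t], of S] d0 by (simp add: S_def d'_def add.assoc)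
      also have "S * (- 1 / 2 * x - 1 / 2 * y) = - (S * (x + y)) / 2" for x y
        by (simp add: algebra_simps add_divide_distrib diff_divide_distrib)
      finally have "0 - (- \<i> * of_real \<omega> * (phase \<omega> t * d)) =
          - (S * (S * \<psi> (n + 1) t + of_real (s (n + 1)) * \<psi> (n + 2) t + phase \<omega> t * d')) / 2"
        by (rule vector_derivative_unique_at[OF A])
      then show ?thesis
        unfolding q q' by (simp add: field_simps)
    qed
    \<comment> \<open>Keeping the factor \<open>S\<close> instead of dividing by it covers undamped
      points too.\<close>
    have pp: "S * p n t = phase \<omega> t * ((- 2 * \<i> * of_real \<omega> - S * (Z - 1)) * d) - S * p (n - 1) t" for t
      using avg[of t] by (simp add: algebra_simps)
    \<comment> \<open>Inserting \<open>pp\<close> into the equation for \<open>\<phi>\<close>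
      removes the unknown constant \<open>p (n - 1)\<close>, so the derivative is a multiple of
      \<open>d\<close>. Once \<open>d = 0\<close>, this is the second half of the induction
      claim.\<close>
    have pn: "(p n has_vector_derivative phase \<omega> t * ((\<i> * of_real \<omega> + S * (Z - 2) / 2) * d)) (at t)" for t
    proof -
      have "((\<lambda>t. S * \<phi> n t) has_vector_derivative
        S * (- 1 / 2 * (p (n - 1) t + p n t) - 1 / 2 * (phase \<omega> t * d))) (at t)"
        using has_vector_derivative_mult_right[OF \<phi>[of n t], of S] d0 by (simp add: p_def d_def)
      also have "S * (- 1 / 2 * (p (n - 1) t + p n t) - 1 / 2 * (phase \<omega> t * d)) =
          - 1 / 2 * (S * p (n - 1) t + S * p n t) - S / 2 * (phase \<omega> t * d)"
        by (simp add: algebra_simps)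
      also have "\<dots> = phase \<omega> t * ((\<i> * of_real \<omega> + S * (Z - 2) / 2) * d)"
        unfolding pp using h by (simp add: field_simps)
      finally show ?thesis by (simp add: p_def[abs_def] S_def)
    qed
    \<comment> \<open>Differentiating \<open>pp\<close> and multiplying \<open>pn\<close> by
      \<open>S\<close> must agree.\<close>
    have "S * (phase \<omega> 0 * ((\<i> * of_real \<omega> + S * (Z - 2) / 2) * d)) =
      - \<i> * of_real \<omega> * (phase \<omega> 0 * ((- 2 * \<i> * of_real \<omega> - S * (Z - 1)) * d)) - S * 0"
    proof (rule vector_derivative_unique_at)
      show "((\<lambda>t. S * p n t) has_vector_derivative
        S * (phase \<omega> 0 * ((\<i> * of_real \<omega> + S * (Z - 2) / 2) * d))) (at 0)"
        by (intro has_vector_derivative_mult_right pn)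
      show "((\<lambda>t. S * p n t) has_vector_derivative
        - \<i> * of_real \<omega> * (phase \<omega> 0 * ((- 2 * \<i> * of_real \<omega> - S * (Z - 1)) * d)) - S * 0) (at 0)"
        unfolding pp by (intro has_vector_derivative_diff has_vector_derivative_mult_right p' has_vector_derivative_phase)
    qed
    then have "(4 * (of_real \<omega>)\<^sup>2 + (Z - 2) * (S\<^sup>2 - 2 * \<i> * of_real \<omega> * S)) * d = 0"
      using h by (simp add: field_simps power2_eq_square)
    then have "d = 0"
      using decay_num_mult_den[OF \<omega> z, of "s n"] num[of n] den[of n] \<omega> by (auto simp: S_def Z_def)
    then have "\<forall>j\<le>n + 1. \<delta> j = 0"
      using step.IH h by (metis d_def divide_eq_0_iff of_real_eq_0_iff less_irrefl zle_add1_eq_le order_le_less)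
    with pn \<open>d = 0\<close> show ?case by simp
  qed
  from this[of "max n (- 1)"] show ?thesis by auto
qed

section \<open>Uniqueness among separated fields\<close>

text \<open>The factors of a product are determined only up to constants. Prescribing them at
  negative arguments fixes these constants, so fields can be compared factor by factor.\<close>

definition exponential_at_negatives :: "real \<Rightarrow> ('d \<Rightarrow> complex) \<Rightarrow> ('d \<Rightarrow> int \<Rightarrow> complex) \<Rightarrow> bool" where
  "exponential_at_negatives h k w \<longleftrightarrow> (\<forall>\<alpha>. \<forall>n<0. w \<alpha> n = exp (\<i> * k \<alpha> * of_real h * of_int n))"

lemma exponential_at_negatives_shift:
  fixes w :: "'d::finite \<Rightarrow> int \<Rightarrow> complex"
  assumes "exponential_at_negatives h k w" and "i \<beta> < 0" and "m < 0"
  shows "(\<Prod>\<alpha>\<in>UNIV. w \<alpha> ((i(\<beta> := m)) \<alpha>)) =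
    exp (\<i> * k \<beta> * of_real h * of_int (m - i \<beta>)) * (\<Prod>\<alpha>\<in>UNIV. w \<alpha> (i \<alpha>))"
proof -
  have "w \<beta> m = exp (\<i> * k \<beta> * of_real h * of_int (m - i \<beta>)) * w \<beta> (i \<beta>)"
    using assms by (simp add: exponential_at_negatives_def ring_distribs flip: exp_add)
  then show ?thesis
    unfolding UNIV_prod_fun_upd[of w i \<beta> m] by (simp add: prod.remove[of UNIV \<beta> "\<lambda>\<alpha>. w \<alpha> (i \<alpha>)"])
qed

lemma separated_extension_form:
  fixes k :: "'d::finite \<Rightarrow> complex"
  assumes "separated V"
    and "\<And>t i. i \<in> physical_domain \<Longrightarrow> V t i = traveling_wave h k \<omega> t i"
  obtains w where "exponential_at_negatives h k w" "\<And>t i. V t i = phase \<omega> t * (\<Prod>\<alpha>\<in>UNIV. w \<alpha> (i \<alpha>))"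
proof -
  obtain T u where V: "\<And>t i. V t i = T t * (\<Prod>\<alpha>\<in>UNIV. u \<alpha> (i \<alpha>))"
    using assms(1) by (auto simp: separated_def)
  define e where "e \<alpha> n = exp (\<i> * k \<alpha> * of_real h * of_int n)" for \<alpha> n
  \<comment> \<open>Normalises each factor at \<open>- 1\<close>; the constants go into the time
    factor. The wave is nonzero, so \<open>u \<alpha> (- 1)\<close> is too.\<close>
  define w where "w \<alpha> n = e \<alpha> (- 1) / u \<alpha> (- 1) * u \<alpha> n" for \<alpha> n
  let ?i = "\<lambda>_ :: 'd. - 1 :: int"
  define P where "P = (\<Prod>\<alpha>\<in>UNIV. e \<alpha> (- 1))"
  define Q where "Q = (\<Prod>\<alpha>\<in>UNIV. u \<alpha> (- 1))"
  have phys: "T t * (\<Prod>\<alpha>\<in>UNIV. u \<alpha> (i \<alpha>)) = phase \<omega> t * (\<Prod>\<alpha>\<in>UNIV. e \<alpha> (i \<alpha>))"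
    if "\<And>\<alpha>. i \<alpha> < 0" for t i
    using assms(2)[of i t] that by (simp add: V traveling_wave_eq_prod e_def physical_domain_def)
  have TQ: "T t * Q = phase \<omega> t * P" for t
    using phys[of ?i t] by (simp add: P_def Q_def)
  have "P \<noteq> 0" by (simp add: P_def e_def)
  with TQ[of 0] have "Q \<noteq> 0" by auto
  then have u: "u \<alpha> (- 1) \<noteq> 0" for \<alpha> by (simp add: Q_def)
  have form: "V t i = phase \<omega> t * (\<Prod>\<alpha>\<in>UNIV. w \<alpha> (i \<alpha>))" for t i
  proof -
    have "(\<Prod>\<alpha>\<in>UNIV. w \<alpha> (i \<alpha>)) = P / Q * (\<Prod>\<alpha>\<in>UNIV. u \<alpha> (i \<alpha>))"
      by (simp only: w_def P_def Q_def prod.distrib prod_dividef)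
    moreover have "T t = phase \<omega> t * P / Q" using TQ[of t] \<open>Q \<noteq> 0\<close> by (simp add: field_simps)
    ultimately show ?thesis by (simp add: V)
  qed
  have "w \<alpha> n = e \<alpha> n" if "n < 0" for \<alpha> n
  proof -
    \<comment> \<open>Only coordinate \<open>\<alpha>\<close> moves; at \<open>- 1\<close> the other
      factors already agree and cancel.\<close>
    let ?j = "?i(\<alpha> := n)"
    have "phase \<omega> 0 * (\<Prod>\<beta>\<in>UNIV. w \<beta> (?j \<beta>)) = phase \<omega> 0 * (\<Prod>\<beta>\<in>UNIV. e \<beta> (?j \<beta>))"
      using phys[of ?j 0] that form[of 0 ?j] V[of 0 ?j] by simp
    then have "w \<alpha> n * (\<Prod>\<beta>\<in>UNIV - {\<alpha>}. w \<beta> (- 1)) = e \<alpha> n * (\<Prod>\<beta>\<in>UNIV - {\<alpha>}. e \<beta> (- 1))"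
      unfolding UNIV_prod_fun_upd[of w ?i \<alpha> n] UNIV_prod_fun_upd[of e ?i \<alpha> n] by simp
    moreover have "w \<beta> (- 1) = e \<beta> (- 1)" for \<beta>
      by (simp add: w_def u)
    moreover have "(\<Prod>\<beta>\<in>UNIV - {\<alpha>}. e \<beta> (- 1)) \<noteq> 0"
      by (simp add: e_def)
    ultimately show ?thesis by simp
  qed
  then have "exponential_at_negatives h k w"
    by (simp add: exponential_at_negatives_def e_def)
  with form that show ?thesis by blast
qed

lemma separated_PML_solution_unique:
  fixes k :: "'d::finite \<Rightarrow> complex"
  assumes h: "h > 0" and \<omega>: "\<omega> \<noteq> 0" and \<sigma>: "\<And>\<alpha> n. n < 0 \<Longrightarrow> \<sigma> \<alpha> n = 0"
    and num: "\<And>\<alpha> n. decay_num h (\<sigma> \<alpha> n) (k \<alpha>) \<omega> \<noteq> 0"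
    and den: "\<And>\<alpha> n. decay_den h (\<sigma> \<alpha> n) (k \<alpha>) \<omega> \<noteq> 0"
    and wave: "discrete_wave_equation_on h physical_domain (traveling_wave h k \<omega>)"
    and v: "exponential_at_negatives h k v" and w: "exponential_at_negatives h k w"
    and V: "\<And>t i. V t i = phase \<omega> t * (\<Prod>\<alpha>\<in>UNIV. v \<alpha> (i \<alpha>))"
    and W: "\<And>t i. W t i = phase \<omega> t * (\<Prod>\<alpha>\<in>UNIV. w \<alpha> (i \<alpha>))"
    and PMLV: "discrete_PML h \<sigma> V \<Phi>V \<Psi>V" and PMLW: "discrete_PML h \<sigma> W \<Phi>W \<Psi>W"
  shows "w \<alpha> n = v \<alpha> n"
proof -
  define D where "D t i = W t i - V t i" for t i
  define \<Phi> where "\<Phi> \<alpha> t i = \<Phi>W \<alpha> t i - \<Phi>V \<alpha> t i" for \<alpha> t i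
  define \<Psi> where "\<Psi> \<alpha> t i = \<Psi>W \<alpha> t i - \<Psi>V \<alpha> t i" for \<alpha> t i
  \<comment> \<open>With \<open>- 2\<close> in the other directions both neighbours
    \<open>- 3\<close> and \<open>- 1\<close> stay negative. There the difference is still
    exponential and the transverse damping is zero; \<open>- 1\<close> would reach the unknown value
    at \<open>0\<close>.\<close>
  define i where "i n = (\<lambda>_ :: 'd. - 2 :: int)(\<alpha> := n)" for n
  define c where "c = (\<Prod>\<beta>\<in>UNIV - {\<alpha>}. exp (\<i> * k \<beta> * of_real h * of_int (- 2)))"
  define \<delta> where "\<delta> n = (w \<alpha> n - v \<alpha> n) * c" for n
  define z where "z \<beta> = exp (\<i> * k \<beta> * of_real h)" for \<beta>
  have z_inv: "exp (- \<i> * k \<beta> * of_real h) = 1 / z \<beta>" for \<beta>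
    by (simp add: z_def exp_minus field_simps)
  have PML: "discrete_PML h \<sigma> D \<Phi> \<Psi>"
    unfolding D_def[abs_def] \<Phi>_def[abs_def] \<Psi>_def[abs_def]
    by (rule discrete_PML_diff[OF PMLW PMLV])
  have i_eq: "i n \<alpha> = n" "(i n)(\<alpha> := m) = i m" "\<beta> \<noteq> \<alpha> \<Longrightarrow> i n \<beta> = - 2" for n m \<beta>
    by (simp_all add: i_def)
  have line: "D t (i n) = phase \<omega> t * \<delta> n" for t n
  proof -
    have "(\<Prod>\<beta>\<in>UNIV. u \<beta> (i n \<beta>)) = u \<alpha> n * c" if "exponential_at_negatives h k u" for u
      using that unfolding i_def UNIV_prod_fun_upd[of u "\<lambda>_. - 2" \<alpha> n] by (simp add: c_def exponential_at_negatives_def)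
    from this[OF v] this[OF w] show ?thesis
      by (simp add: D_def V W \<delta>_def algebra_simps)
  qed
  have across: "D t ((i n)(\<beta> := - 3)) = 1 / z \<beta> * D t (i n)" "D t ((i n)(\<beta> := - 1)) = z \<beta> * D t (i n)"
    if "\<beta> \<noteq> \<alpha>" for t n \<beta>
  proof -
    have "D t ((i n)(\<beta> := m)) = exp (\<i> * k \<beta> * of_real h * of_int (m + 2)) * D t (i n)" if "m < 0" for m
      using exponential_at_negatives_shift[OF v, of "i n" \<beta> m] exponential_at_negatives_shift[OF w, of "i n" \<beta> m] \<open>\<beta> \<noteq> \<alpha>\<close> that
      by (simp add: D_def V W i_eq algebra_simps)
    from this[of "- 3"] this[of "- 1"] show "D t ((i n)(\<beta> := - 3)) = 1 / z \<beta> * D t (i n)"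
      "D t ((i n)(\<beta> := - 1)) = z \<beta> * D t (i n)"
      using z_inv[of \<beta>] by (simp_all add: z_def)
  qed
  have "\<delta> n = 0" for n
  proof (rule line_solution_unique[where s = "\<sigma> \<alpha>" and k = "k \<alpha>" and z = "z \<alpha>" and \<phi> = "\<lambda>n t. \<Phi> \<alpha> t (i n)"
        and \<psi> = "\<lambda>n t. \<Psi> \<alpha> t (i n)", OF h \<omega>], goal_cases)
    case (5 n)
    then show ?case using v w by (simp add: \<delta>_def exponential_at_negatives_def)
  next
    case (6 n t)
    from PML[unfolded discrete_PML_def, THEN conjunct2, THEN conjunct1, rule_format, of \<alpha> "i n" t]
    show ?case by (simp add: shift_def damping_def i_eq line)
  next
    case (7 n t)
    from PML[unfolded discrete_PML_def, THEN conjunct2, THEN conjunct2, rule_format, of \<alpha> "i n" t]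
    show ?case by (simp add: shift_def damping_def i_eq line)
  next
    case (8 n t)
    define L where "L \<beta> = 1 / (of_real h)\<^sup>2 * (z \<beta> + 1 / z \<beta> - 2)" for \<beta>
    define A where "A = of_real (\<sigma> \<alpha> n) * \<Psi> \<alpha> t (i (n + 1)) - of_real (\<sigma> \<alpha> (n - 1)) * \<Phi> \<alpha> t (i (n - 1))"
    have "has_second_derivative (\<lambda>t. phase \<omega> t * \<delta> n)
        (\<lambda>t. discrete_laplacian h (D t) (i n)
           + (\<Sum>\<beta>\<in>UNIV. 1 / of_real h * (damping \<sigma> \<beta> (i n) * shift \<beta> 1 (\<Psi> \<beta> t) (i n)
                 - shift \<beta> (-1) (damping \<sigma> \<beta>) (i n) * shift \<beta> (-1) (\<Phi> \<beta> t) (i n))))"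
      using PML[unfolded discrete_PML_def, THEN conjunct1, rule_format, of "i n"] by (simp only: line)
    then have "discrete_laplacian h (D t) (i n)
           + (\<Sum>\<beta>\<in>UNIV. 1 / of_real h * (damping \<sigma> \<beta> (i n) * shift \<beta> 1 (\<Psi> \<beta> t) (i n)
                 - shift \<beta> (-1) (damping \<sigma> \<beta>) (i n) * shift \<beta> (-1) (\<Phi> \<beta> t) (i n)))
         = - (of_real \<omega>)\<^sup>2 * (phase \<omega> t * \<delta> n)"
      by (simp only: has_second_derivative_phase_iff)
    moreover have "(\<Sum>\<beta>\<in>UNIV. 1 / of_real h * (damping \<sigma> \<beta> (i n) * shift \<beta> 1 (\<Psi> \<beta> t) (i n)
                 - shift \<beta> (-1) (damping \<sigma> \<beta>) (i n) * shift \<beta> (-1) (\<Phi> \<beta> t) (i n))) = 1 / of_real h * A"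
      (is "sum ?F UNIV = _")
    proof -
      have "sum ?F (UNIV - {\<alpha>}) = 0"
        by (rule sum.neutral) (simp add: damping_def shift_def i_eq \<sigma>)
      moreover have "?F \<alpha> = 1 / of_real h * A"
        by (simp add: damping_def shift_def i_eq A_def)
      ultimately show ?thesis
        using sum.remove[of UNIV \<alpha> ?F] by simp
    qed
    moreover have "discrete_laplacian h (D t) (i n) =
        1 / (of_real h)\<^sup>2 * (- 2 * \<delta> n + \<delta> (n - 1) + \<delta> (n + 1)) * phase \<omega> t
        + (\<Sum>\<beta>\<in>UNIV - {\<alpha>}. L \<beta>) * (phase \<omega> t * \<delta> n)"
    proof -
      have "1 / (of_real h)\<^sup>2 * (- 2 * D t (i n) + shift \<beta> (-1) (D t) (i n) + shift \<beta> 1 (D t) (i n))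
          = L \<beta> * (phase \<omega> t * \<delta> n)" if "\<beta> \<noteq> \<alpha>" for \<beta>
        using that by (simp add: shift_def i_eq across line L_def algebra_simps diff_divide_distrib add_divide_distrib)
      then have "(\<Sum>\<beta>\<in>UNIV - {\<alpha>}. 1 / (of_real h)\<^sup>2 *
           (- 2 * D t (i n) + shift \<beta> (-1) (D t) (i n) + shift \<beta> 1 (D t) (i n)))
          = (\<Sum>\<beta>\<in>UNIV - {\<alpha>}. L \<beta>) * (phase \<omega> t * \<delta> n)"
        unfolding sum_distrib_right by (intro sum.cong) auto
      then show ?thesis
        unfolding discrete_laplacian_def
        by (simp add: sum.remove[of UNIV \<alpha>] shift_def i_eq line algebra_simps diff_divide_distrib add_divide_distrib)
    qed
    \<comment> \<open>The transverse symbols appear on both sides of the wave equation and cancel,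
      leaving only direction \<open>\<alpha>\<close>.\<close>
    moreover have "- (of_real \<omega>)\<^sup>2 = L \<alpha> + (\<Sum>\<beta>\<in>UNIV - {\<alpha>}. L \<beta>)"
      using dispersion_relation[OF wave] unfolding z_inv unfolding L_def z_def
      by (simp add: sum.remove[of UNIV \<alpha>])
    ultimately have "1 / (of_real h)\<^sup>2 * (- 2 * \<delta> n + \<delta> (n - 1) + \<delta> (n + 1)) * phase \<omega> t + 1 / of_real h * A
        = L \<alpha> * (phase \<omega> t * \<delta> n)"
      by (simp add: algebra_simps)
    then have "A = of_real h * (L \<alpha> * (phase \<omega> t * \<delta> n)
        - 1 / (of_real h)\<^sup>2 * (- 2 * \<delta> n + \<delta> (n - 1) + \<delta> (n + 1)) * phase \<omega> t)"
      using h by (simp add: field_simps)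
    also have "\<dots> = phase \<omega> t * (((z \<alpha> + 1 / z \<alpha>) * \<delta> n - \<delta> (n + 1) - \<delta> (n - 1)) / of_real h)"
      using h by (simp add: L_def field_simps power2_eq_square)
    finally show ?case by (simp add: A_def)
  qed (use \<sigma> num den z_def in auto)
  moreover have "c \<noteq> 0" by (simp add: c_def)
  ultimately show ?thesis by (simp add: \<delta>_def)
qed

section \<open>Estimates for the decay rate\<close>

lemma cmod_decay_den:
  "(cmod (decay_den h s k \<omega>))\<^sup>2 =
     (2 + s / \<omega> * exp (- Im k * h) * sin (Re k * h))\<^sup>2 + (s / \<omega>)\<^sup>2 * (1 - exp (- Im k * h) * cos (Re k * h))\<^sup>2"
  by (simp add: cmod_power2 decay_den_def Re_exp Im_exp power_mult_distrib power_divide mult.assoc)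

lemma decay_num_eq_den: "decay_num h s k \<omega> = decay_den h s (- k) \<omega>"
  by (simp add: decay_num_def decay_den_def)

text \<open>A zero would need \<open>r * cos (Re k * h) = 1\<close> with \<open>r \<le> 1\<close>,
  hence cosine \<open>1\<close> and sine \<open>0\<close>, but then the real part is
  \<open>2\<close>. In the denominator the exponential is at least \<open>1\<close> and this
  fails.\<close>

lemma decay_num_nonzero:
  assumes "h > 0" and "Im k \<le> 0"
  shows "decay_num h s k \<omega> \<noteq> 0"
proof
  assume "decay_num h s k \<omega> = 0"
  define r where "r = exp (Im k * h)"
  have r: "0 < r" "r \<le> 1"
    using assms by (auto simp: r_def mult_nonpos_nonneg)
  have "(2 - s / \<omega> * r * sin (Re k * h))\<^sup>2 + (s / \<omega> * (1 - r * cos (Re k * h)))\<^sup>2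
      = (cmod (decay_den h s (- k) \<omega>))\<^sup>2"
    unfolding cmod_decay_den power_mult_distrib by (simp add: r_def)
  also have "\<dots> = 0"
    using \<open>decay_num h s k \<omega> = 0\<close> by (simp add: decay_num_eq_den)
  finally have "2 - s / \<omega> * r * sin (Re k * h) = 0" and *: "s / \<omega> * (1 - r * cos (Re k * h)) = 0"
    by (simp_all only: sum_power2_eq_zero_iff)
  then have "s / \<omega> \<noteq> 0" and sin: "sin (Re k * h) \<noteq> 0" by auto
  with * have rc: "r * cos (Re k * h) = 1" by simp
  then have "cos (Re k * h) > 0" using r by (metis zero_less_mult_pos zero_less_one)
  then have "r * cos (Re k * h) \<le> cos (Re k * h)" using r by (simp add: mult_left_le_one_le)
  then have "cos (Re k * h) = 1" using rc cos_le_one[of "Re k * h"] by linarith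
  then show False using sin sin_cos_squared_add[of "Re k * h"] by simp
qed

text \<open>The squared moduli differ by \<open>4 * c * S * (R + r)\<close>, positive by the
  direction of travel, plus \<open>c\<^sup>2 * (R - r) * (R + r - 2 * C)\<close>. The latter is
  nonnegative since \<open>R * r = 1\<close> gives \<open>R + r \<ge> 2\<close>.\<close>

lemma cmod_decay_num_less_den:
  assumes h: "h > 0" and "Im k \<le> 0" and pos: "s / \<omega> * sin (Re k * h) > 0"
  shows "cmod (decay_num h s k \<omega>) < cmod (decay_den h s k \<omega>)"
proof -
  define R where "R = exp (- Im k * h)"
  define r where "r = exp (Im k * h)"
  define c where "c = s / \<omega>"
  define S where "S = sin (Re k * h)"
  define C where "C = cos (Re k * h)"
  have Rr: "R * r = 1" by (simp add: R_def r_def flip: exp_add)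
  have "R > 0" "r > 0" by (simp_all add: R_def r_def)
  have "R \<ge> r" using assms by (simp add: R_def r_def mult_nonpos_nonneg)
  have "R + r \<ge> 2"
  proof -
    have "(R + r)\<^sup>2 = (R - r)\<^sup>2 + 2\<^sup>2" using Rr by (simp add: power2_eq_square algebra_simps)
    then have "2\<^sup>2 \<le> (R + r)\<^sup>2" by simp
    then show ?thesis using \<open>R > 0\<close> \<open>r > 0\<close> by (meson add_pos_pos less_imp_le power2_le_imp_le)
  qed
  then have "(R + r) - 2 * C \<ge> 0" using cos_le_one[of "Re k * h"] unfolding C_def by linarith
  then have nonneg: "0 \<le> c\<^sup>2 * ((R - r) * ((R + r) - 2 * C))" using \<open>R \<ge> r\<close> by simp
  have "0 < 4 * (c * S) * (R + r)"
    by (rule mult_pos_pos) (use pos \<open>R > 0\<close> \<open>r > 0\<close> in \<open>simp_all add: c_def S_def\<close>)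
  moreover have "((2 + c * R * S)\<^sup>2 + c\<^sup>2 * (1 - R * C)\<^sup>2) - ((2 - c * r * S)\<^sup>2 + c\<^sup>2 * (1 - r * C)\<^sup>2)
      = 4 * (c * S) * (R + r) + c\<^sup>2 * ((R - r) * ((R + r) - 2 * C))"
  proof -
    have "((2 + c * R * S)\<^sup>2 + c\<^sup>2 * (1 - R * C)\<^sup>2) - ((2 - c * r * S)\<^sup>2 + c\<^sup>2 * (1 - r * C)\<^sup>2)
        = 4 * (c * S) * (R + r) + c\<^sup>2 * ((R\<^sup>2 - r\<^sup>2) * (S\<^sup>2 + C\<^sup>2) - 2 * C * (R - r))"
      by (simp add: power2_eq_square algebra_simps)
    also have "(R\<^sup>2 - r\<^sup>2) * (S\<^sup>2 + C\<^sup>2) - 2 * C * (R - r) = (R - r) * ((R + r) - 2 * C)"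
      by (simp add: S_def C_def power2_eq_square[of R] power2_eq_square[of r]) (simp add: algebra_simps)
    finally show ?thesis .
  qed
  moreover have "(cmod (decay_num h s k \<omega>))\<^sup>2 = (2 - c * r * S)\<^sup>2 + c\<^sup>2 * (1 - r * C)\<^sup>2"
    unfolding decay_num_eq_den cmod_decay_den by (simp add: c_def r_def S_def C_def)
  moreover have "(cmod (decay_den h s k \<omega>))\<^sup>2 = (2 + c * R * S)\<^sup>2 + c\<^sup>2 * (1 - R * C)\<^sup>2"
    unfolding cmod_decay_den by (simp add: c_def R_def S_def C_def)
  ultimately have "(cmod (decay_num h s k \<omega>))\<^sup>2 < (cmod (decay_den h s k \<omega>))\<^sup>2"
    using nonneg by linarith
  then show ?thesis by (rule power2_less_imp_less) simp
qed

text \<open>Reflection flips \<open>Re k\<close> and keeps \<open>Im k\<close>, so in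
  \<open>cmod_decay_den\<close> only the sine term changes sign.\<close>

lemma cmod_decay_den_reflected_less:
  assumes "s / \<omega> * sin (Re k * h) > 0"
  shows "cmod (decay_den h s (- cnj k) \<omega>) < cmod (decay_den h s k \<omega>)"
proof -
  define x where "x = s / \<omega> * exp (- Im k * h) * sin (Re k * h)"
  have "x > 0" using assms mult_pos_pos[OF assms, of "exp (- Im k * h)"] by (simp add: x_def mult_ac)
  then have "(2 - x)\<^sup>2 < (2 + x)\<^sup>2" by (simp add: power2_eq_square algebra_simps)
  then have "(cmod (decay_den h s (- cnj k) \<omega>))\<^sup>2 < (cmod (decay_den h s k \<omega>))\<^sup>2"
    by (simp add: cmod_decay_den x_def)
  then show ?thesis by (rule power2_less_imp_less) simp
qed

text \<open>The previous bound puts no sign condition on \<open>Im k\<close>, so it applies to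
  \<open>cnj k\<close>, whose reflection \<open>- k\<close> turns the denominator into the
  numerator.\<close>

lemma cmod_decay_num_reflected_greater:
  assumes "s / \<omega> * sin (Re k * h) > 0"
  shows "cmod (decay_num h s k \<omega>) < cmod (decay_num h s (- cnj k) \<omega>)"
  using cmod_decay_den_reflected_less[of s \<omega> "cnj k" h] assms by (simp add: decay_num_eq_den)

lemma decay_rate_bounds:
  assumes h: "h > 0" and s: "s > 0" and \<kappa>: "Im \<kappa> \<le> 0" and dir: "sgn \<omega> * Re \<kappa> \<in> {0<..<pi / h}"
  shows "decay_den h s \<kappa> \<omega> \<noteq> 0" and "decay_num h s (- cnj \<kappa>) \<omega> \<noteq> 0"
    and "norm (decay_rate h s \<kappa> \<omega>) < 1"
    and "norm (decay_rate h s \<kappa> \<omega>) / norm (decay_rate h s (- cnj \<kappa>) \<omega>) < 1"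
proof -
  \<comment> \<open>The direction condition gives \<open>s / \<omega>\<close> and
    \<open>sin (Re \<kappa> * h)\<close> the same sign.\<close>
  have "0 < sgn \<omega> * Re \<kappa> * h" "sgn \<omega> * Re \<kappa> * h < pi"
    using dir h by (auto simp: pos_less_divide_eq)
  then have sin: "0 < sin (sgn \<omega> * Re \<kappa> * h)" by (rule sin_gt_zero)
  have "s / \<omega> * sin (Re \<kappa> * h) > 0"
  proof (cases "\<omega> > 0")
    case True
    with s sin show ?thesis by simp
  next
    case False
    with dir have "\<omega> < 0" by (cases "\<omega> = 0") auto
    with sin have "sin (Re \<kappa> * h) < 0" by simp
    moreover have "s / \<omega> < 0" using s \<open>\<omega> < 0\<close> by (simp add: divide_pos_neg)
    ultimately show ?thesis by (rule mult_neg_neg[rotated])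
  qed
  note less = cmod_decay_num_less_den[OF h \<kappa> this] cmod_decay_den_reflected_less[OF this]
    cmod_decay_num_reflected_greater[OF this]
  show "decay_den h s \<kappa> \<omega> \<noteq> 0" "decay_num h s (- cnj \<kappa>) \<omega> \<noteq> 0"
    using less by auto
  then show "norm (decay_rate h s \<kappa> \<omega>) < 1"
    using less(1) by (simp add: decay_rate_def norm_divide divide_less_eq_1)
  show "norm (decay_rate h s \<kappa> \<omega>) / norm (decay_rate h s (- cnj \<kappa>) \<omega>) < 1"
  proof (cases "decay_den h s (- cnj \<kappa>) \<omega> = 0") \<comment> \<open>if so, the ratio is \<open>0\<close> because \<open>x / 0 = 0\<close>\<close>
    case False
    \<comment> \<open>The quotient of rates is a quotient of numerators times one of denominators,
      each below \<open>1\<close>.\<close>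
    have "norm (decay_num h s \<kappa> \<omega>) * norm (decay_den h s (- cnj \<kappa>) \<omega>)
        < norm (decay_num h s (- cnj \<kappa>) \<omega>) * norm (decay_den h s \<kappa> \<omega>)"
      using less(2,3) by (intro mult_strict_mono') auto
    moreover have "norm (decay_rate h s \<kappa> \<omega>) / norm (decay_rate h s (- cnj \<kappa>) \<omega>) =
        (norm (decay_num h s \<kappa> \<omega>) * norm (decay_den h s (- cnj \<kappa>) \<omega>)) /
        (norm (decay_num h s (- cnj \<kappa>) \<omega>) * norm (decay_den h s \<kappa> \<omega>))"
      by (simp add: decay_rate_def norm_divide mult_ac)
    moreover have "0 < norm (decay_num h s (- cnj \<kappa>) \<omega>) * norm (decay_den h s \<kappa> \<omega>)"
      using \<open>decay_den h s \<kappa> \<omega> \<noteq> 0\<close> \<open>decay_num h s (- cnj \<kappa>) \<omega> \<noteq> 0\<close> by simp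
    ultimately show ?thesis by simp
  qed (simp add: decay_rate_def)
qed

text \<open>The condition on \<open>decay_den\<close> guards against poles of the rate: when
  \<open>sgn \<omega> * Re k < 0\<close>, the denominator can vanish for some \<open>k\<close> with
  \<open>Im k < 0\<close>.\<close>

theorem theorem1p1:
  fixes h :: real and \<sigma> :: "'d::finite \<Rightarrow> int \<Rightarrow> real"
  assumes "h > 0"
    and "\<And>\<alpha> i. \<sigma> \<alpha> i \<ge> 0"
    and "\<And>\<alpha> i. i < 0 \<Longrightarrow> \<sigma> \<alpha> i = 0"
  shows
    "(\<forall>(k :: 'd \<Rightarrow> complex) (\<omega> :: real).
        (\<forall>\<alpha>. k \<alpha> \<in> wave_numbers h) \<longrightarrow> \<omega> \<noteq> 0 \<longrightarrow>
        discrete_wave_equation_on h physical_domain (traveling_wave h k \<omega>) \<longrightarrow>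
        (\<forall>\<alpha>. \<forall>j\<ge>0. decay_den h (\<sigma> \<alpha> j) (k \<alpha>) \<omega> \<noteq> 0) \<longrightarrow>
          separated (attenuated_wave h \<sigma> k \<omega>) \<and>
          PML_extension h \<sigma> (traveling_wave h k \<omega>) (attenuated_wave h \<sigma> k \<omega>) \<and>
          (\<forall>V. separated V \<and> PML_extension h \<sigma> (traveling_wave h k \<omega>) V \<longrightarrow>
               V = attenuated_wave h \<sigma> k \<omega>)) \<and>
     (\<forall>(s :: real) (\<omega> :: real) (\<kappa> :: complex).
        s > 0 \<longrightarrow> \<omega> \<noteq> 0 \<longrightarrow> \<kappa> \<in> wave_numbers h \<longrightarrow> sgn \<omega> * Re \<kappa> \<in> {0<..<pi / h} \<longrightarrow>
          decay_den h s \<kappa> \<omega> \<noteq> 0 \<and> decay_num h s (- cnj \<kappa>) \<omega> \<noteq> 0 \<and>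
          norm (decay_rate h s \<kappa> \<omega>) < 1 \<and>
          norm (decay_rate h s \<kappa> \<omega>) / norm (decay_rate h s (- cnj \<kappa>) \<omega>) < 1)"
proof (intro conjI allI impI, goal_cases)
  case (1 k \<omega>)
  then show ?case
    unfolding separated_def
    by (intro exI[of _ "phase \<omega>"] exI[of _ "\<lambda>\<alpha>. layer_mode h (\<sigma> \<alpha>) (k \<alpha>) \<omega>"])
      (simp add: attenuated_wave_eq_prod)
next
  case (2 k \<omega>)
  \<comment> \<open>The hypothesis covers \<open>n \<ge> 0\<close>; for negative \<open>n\<close>
    the denominator is \<open>2\<close>.\<close>
  have den: "decay_den h (\<sigma> \<alpha> n) (k \<alpha>) \<omega> \<noteq> 0" for \<alpha> n
    using 2 assms(3)[of n \<alpha>] by (cases "n < 0") (auto simp: decay_den_def)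
  have "attenuated_wave h \<sigma> k \<omega> t i = traveling_wave h k \<omega> t i" if "i \<in> physical_domain" for t i
  proof -
    have "i \<alpha> \<le> 0" for \<alpha>
      using that by (simp add: physical_domain_def less_imp_le)
    then show ?thesis by (simp add: attenuated_wave_def attenuation_def)
  qed
  moreover have "\<exists>\<Phi> \<Psi>. discrete_PML h \<sigma> (attenuated_wave h \<sigma> k \<omega>) \<Phi> \<Psi>"
    using 2 by (intro attenuated_wave_PML assms(1,3) den)
  ultimately show ?case
    unfolding PML_extension_def by blast
next
  case (3 k \<omega> V)
  have den: "decay_den h (\<sigma> \<alpha> n) (k \<alpha>) \<omega> \<noteq> 0" for \<alpha> n
    using 3 assms(3)[of n \<alpha>] by (cases "n < 0") (auto simp: decay_den_def)
  have num: "decay_num h (\<sigma> \<alpha> n) (k \<alpha>) \<omega> \<noteq> 0" for \<alpha> n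
    using 3 by (intro decay_num_nonzero assms(1)) (auto simp: wave_numbers_def)
  have v: "exponential_at_negatives h k (\<lambda>\<alpha>. layer_mode h (\<sigma> \<alpha>) (k \<alpha>) \<omega>)"
    by (simp add: exponential_at_negatives_def layer_mode_nonpos)
  obtain w where w: "exponential_at_negatives h k w" and V: "\<And>t i. V t i = phase \<omega> t * (\<Prod>\<alpha>\<in>UNIV. w \<alpha> (i \<alpha>))"
    using separated_extension_form[of V h k \<omega>] 3 unfolding PML_extension_def by metis
  obtain \<Phi> \<Psi> where PML: "discrete_PML h \<sigma> V \<Phi> \<Psi>"
    using 3 unfolding PML_extension_def by blast
  have "\<exists>\<Phi> \<Psi>. discrete_PML h \<sigma> (attenuated_wave h \<sigma> k \<omega>) \<Phi> \<Psi>"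
    using 3 by (intro attenuated_wave_PML assms(1,3) den)
  then obtain \<Phi>' \<Psi>' where PML': "discrete_PML h \<sigma> (attenuated_wave h \<sigma> k \<omega>) \<Phi>' \<Psi>'"
    by blast
  have "w \<alpha> n = layer_mode h (\<sigma> \<alpha>) (k \<alpha>) \<omega> n" for \<alpha> n
    using 3 by (intro separated_PML_solution_unique[OF assms(1) _ _ _ _ _ v w attenuated_wave_eq_prod V PML' PML]
      assms(3) num den)
  then show ?case
    by (simp add: fun_eq_iff V attenuated_wave_eq_prod)
next
  case (4 s \<omega> \<kappa>)
  then show ?case using decay_rate_bounds(1)[OF assms(1), of s \<kappa> \<omega>] by (simp add: wave_numbers_def)
next
  case (5 s \<omega> \<kappa>)
  then show ?case using decay_rate_bounds(2)[OF assms(1), of s \<kappa> \<omega>] by (simp add: wave_numbers_def)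
next
  case (6 s \<omega> \<kappa>)
  then show ?case using decay_rate_bounds(3)[OF assms(1), of s \<kappa> \<omega>] by (simp add: wave_numbers_def)
next
  case (7 s \<omega> \<kappa>)
  then show ?case using decay_rate_bounds(4)[OF assms(1), of s \<kappa> \<omega>] by (simp add: wave_numbers_def)
qed

end
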